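(* Let $q$ be a prime power, $k\ge 0$, and let $L=L_{q,k}$ be the lattice of subspaces of a $k$-dimensional vector space $V$ over $GF(q)$, with bottom element $\mathbf b=\{0\}$; write $h(A)=\dim A$. Then: (a) If the coverings of $L$ carry a matroidal red/green coloring, and for each $x\in L$ one defines $\rho(x)$ to be the number of red coverings in a maximal chain from $\mathbf b$ to $x$ (this is independent of the chain), then $\rho$ satisfies: (R1) $0\le\rho(A)\le h(A)$; (R2) $A\subseteq B$ implies $\rho(A)\le\rho(B)$; (R3) $\rho(A+B)+\rho(A\cap B)\le\rho(A)+\rho(B)$, for all $A,B\in L$. (b) Conversely, if $\rho$ is an integer-valued function on $L$ satisfying (R1), (R2), (R3), then coloring a covering $[x,y]$ red if $\rho(y)>\rho(x)$ and green otherwise yields a matroidal coloring of the coverings of $L$. Thus $q$-matroids on $L$ defined by rank functions and by matroidal bi-colorings correspond to one another.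
   Context: A covering of $L$ is a pair $[x,y]$ with $x<y$ and $\dim y=\dim x+1$. A diamond is an interval $[x,z]$ of $L$ with $\dim z=\dim x+2$; its lower coverings are the coverings $[x,y]$ and its upper coverings are the coverings $[y,z]$, for $x<y<z$. A red/green coloring of the coverings of $L$ is matroidal if every diamond is of one of four types: (One) all its coverings are red; (Mixed) exactly one lower covering $[x,y]$ is green, and the covering $[y,z]$ above it is the only red upper covering; (Prime) all lower coverings are red and all upper coverings are green; (Zero) all coverings are green. A $q$-matroid on $L$ is a pair $(L,\rho)$ with $\rho$ an integer-valued function on $L$ satisfying (R1)–(R3). *)

theory Defs
  imports "HOL-Number_Theory.Prime_Powers"
begin

datatype color = Red | Green

definition coloring_of_rank :: "('a \<Rightarrow> int) \<Rightarrow> 'a \<Rightarrow> 'a \<Rightarrow> color" where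
  "coloring_of_rank \<rho> x y = (if \<rho> y > \<rho> x then Red else Green)"

locale subspace_lattice = vector_space scale
  for scale :: "'a::field \<Rightarrow> 'b::ab_group_add \<Rightarrow> 'b"
begin

text \<open>The lattice \<open>L\<close> consists of all sets \<open>x\<close> with \<^term>\<open>subspace x\<close>, ordered by inclusion.
  A coloring is represented by a function of the two ends \<open>x\<close>, \<open>y\<close> of a covering \<open>[x, y]\<close>;
  its values at pairs that are not coverings are never used.\<close>

definition interval :: "'b set \<Rightarrow> 'b set \<Rightarrow> 'b set set" where
  "interval x z = {y. subspace y \<and> x \<subseteq> y \<and> y \<subseteq> z}"

definition covering :: "'b set \<Rightarrow> 'b set \<Rightarrow> bool" where
  "covering x y \<longleftrightarrow> subspace x \<and> subspace y \<and> x \<subset> y \<and> dim y = dim x + 1"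

definition diamond :: "'b set \<Rightarrow> 'b set \<Rightarrow> bool" where
  "diamond x z \<longleftrightarrow> subspace x \<and> subspace z \<and> x \<subset> z \<and> dim z = dim x + 2"

definition between :: "'b set \<Rightarrow> 'b set \<Rightarrow> 'b set set" where
  "between x z = {y. subspace y \<and> x \<subset> y \<and> y \<subset> z}"

definition type_One :: "('b set \<Rightarrow> 'b set \<Rightarrow> color) \<Rightarrow> 'b set \<Rightarrow> 'b set \<Rightarrow> bool" where
  "type_One c x z \<longleftrightarrow> (\<forall>y\<in>between x z. c x y = Red \<and> c y z = Red)"

definition type_Mixed :: "('b set \<Rightarrow> 'b set \<Rightarrow> color) \<Rightarrow> 'b set \<Rightarrow> 'b set \<Rightarrow> bool" where
  "type_Mixed c x z \<longleftrightarrow>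
     (\<exists>y\<in>between x z.
        (\<forall>y'\<in>between x z. c x y' = Green \<longleftrightarrow> y' = y) \<and>
        (\<forall>y'\<in>between x z. c y' z = Red \<longleftrightarrow> y' = y))"

definition type_Prime :: "('b set \<Rightarrow> 'b set \<Rightarrow> color) \<Rightarrow> 'b set \<Rightarrow> 'b set \<Rightarrow> bool" where
  "type_Prime c x z \<longleftrightarrow> (\<forall>y\<in>between x z. c x y = Red \<and> c y z = Green)"

definition type_Zero :: "('b set \<Rightarrow> 'b set \<Rightarrow> color) \<Rightarrow> 'b set \<Rightarrow> 'b set \<Rightarrow> bool" where
  "type_Zero c x z \<longleftrightarrow> (\<forall>y\<in>between x z. c x y = Green \<and> c y z = Green)"

definition matroidal :: "('b set \<Rightarrow> 'b set \<Rightarrow> color) \<Rightarrow> bool" where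
  "matroidal c \<longleftrightarrow>
     (\<forall>x z. diamond x z \<longrightarrow>
        type_One c x z \<or> type_Mixed c x z \<or> type_Prime c x z \<or> type_Zero c x z)"

definition maximal_chain :: "'b set \<Rightarrow> 'b set \<Rightarrow> 'b set set \<Rightarrow> bool" where
  "maximal_chain x z C \<longleftrightarrow> subset.maxchain (interval x z) C"

lemma maximal_chain_exists: "\<exists>C. maximal_chain x z C"
  unfolding maximal_chain_def by (rule subset.Hausdorff)

definition num_red :: "('b set \<Rightarrow> 'b set \<Rightarrow> color) \<Rightarrow> 'b set set \<Rightarrow> nat" where
  "num_red c C = card {(x, y). x \<in> C \<and> y \<in> C \<and> covering x y \<and> c x y = Red}"

text \<open>The chain in the following definition is an arbitrary one; for a matroidal coloring
  the value does not depend on it.\<close>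

definition rank_of_coloring :: "('b set \<Rightarrow> 'b set \<Rightarrow> color) \<Rightarrow> 'b set \<Rightarrow> int" where
  "rank_of_coloring c x = int (num_red c (SOME C. maximal_chain {0} x C))"

definition q_matroid :: "('b set \<Rightarrow> int) \<Rightarrow> bool" where
  "q_matroid \<rho> \<longleftrightarrow>
     (\<forall>A. subspace A \<longrightarrow> 0 \<le> \<rho> A \<and> \<rho> A \<le> int (dim A)) \<and>
     (\<forall>A B. subspace A \<longrightarrow> subspace B \<longrightarrow> A \<subseteq> B \<longrightarrow> \<rho> A \<le> \<rho> B) \<and>
     (\<forall>A B. subspace A \<longrightarrow> subspace B \<longrightarrow>
        \<rho> {a + b |a b. a \<in> A \<and> b \<in> B} + \<rho> (A \<inter> B) \<le> \<rho> A + \<rho> B)"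

end

end

theory Submission
  imports Defs
begin

text \<open>In each of the four types of diamond the number of red coverings along \<open>x < y < z\<close> does not
  depend on \<open>y\<close>, so a Jordan--Hoelder induction (the lattice is modular: two elements covered by
  \<open>x\<close> cover their intersection) makes the red count of a chain depend only on its ends.
  Moreover, for \<open>y \<noteq> y'\<close> in a diamond, \<open>[y, z]\<close> red forces \<open>[x, y']\<close> red. This is submodularity
  for adding single vectors to a span, and adding vectors one at a time gives (R3).
  Conversely, (R1) for lines and (R3) bound the rank difference of a covering by 1, so the type of
  a diamond is read off its rank difference; when that is 1, two green lower coverings would
  contradict (R3).\<close>

locale finite_subspace_lattice =
  subspace_lattice scale + finite_dimensional_vector_space scale Basis
  for scale :: "'a::{field,finite} \<Rightarrow> 'b::ab_group_add \<Rightarrow> 'b" and Basis :: "'b set"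
begin

section \<open>Finiteness, dimension and coverings of subspaces\<close>

lemma finite_span:
  assumes "finite S"
  shows "finite (span S)"
  using assms
proof induction
  case empty
  then show ?case by simp
next
  case (insert a S)
  \<comment> \<open>One translate of \<open>span S\<close> for each scalar \<open>k\<close>: a
    finite union, because the field is finite.\<close>
  have "span (insert a S) \<subseteq> (\<Union>k. (\<lambda>y. y + scale k a) ` span S)"
  proof
    fix x assume "x \<in> span (insert a S)"
    then obtain k where "x - scale k a \<in> span S"
      by (auto simp: span_insert)
    then have "x \<in> (\<lambda>y. y + scale k a) ` span S"
      by (intro image_eqI[where x = "x - scale k a"]) auto
    then show "x \<in> (\<Union>k. (\<lambda>y. y + scale k a) ` span S)" by blast
  qed
  then show ?case
    using insert.IH by (auto intro: finite_subset)
qed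

text \<open>Makes every chain of subspaces finite and allows inductions that adjoin the vectors of a
  subspace one by one.\<close>

lemma finite_space: "finite (A :: 'b set)"
  using finite_span[OF finite_Basis] span_Basis by (metis finite_subset subset_UNIV)

lemma dim_strict_mono:
  assumes "subspace x" "subspace y" "x \<subset> y"
  shows "dim x < dim y"
  using dim_psubset[of x y] assms by (simp add: span_eq_iff[THEN iffD2])

lemma dim_span_insert: "v \<notin> span S \<Longrightarrow> dim (span (insert v S)) = dim (span S) + 1"
  by (simp add: dim_insert)

lemma covering_span_insert:
  assumes "v \<notin> span S"
  shows "covering (span S) (span (insert v S))"
  unfolding covering_def
  using assms dim_span_insert[OF assms] span_base[of v "insert v S"]
    span_mono[of S "insert v S"]
  by auto

lemma covering_subset: "covering x y \<Longrightarrow> x \<subseteq> y"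
  by (auto simp: covering_def)

lemma covering_eq_span_insert:
  assumes "covering x y" "v \<in> y" "v \<notin> x"
  shows "y = span (insert v x)"
proof -
  have xy: "subspace x" "subspace y" "x \<subseteq> y" "dim y = dim x + 1"
    using assms(1) by (auto simp: covering_def)
  have "v \<notin> span x" using xy assms by (simp add: span_eq_iff[THEN iffD2])
  then have "dim (span (insert v x)) = dim x + 1" using dim_span_insert[of v x] by simp
  moreover have "span (insert v x) \<subseteq> y" using xy assms by (intro span_minimal) auto
  ultimately show ?thesis using subspace_dim_equal[of "span (insert v x)" y] xy by auto
qed

text \<open>Strict inclusion of subspaces raises the dimension, and only one integer lies strictly
  between \<open>dim x\<close> and \<open>dim x + 2\<close>.\<close>

lemma diamond_between_iff:
  assumes "diamond x z"
  shows "y \<in> between x z \<longleftrightarrow> covering x y \<and> covering y z"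
proof
  assume "y \<in> between x z"
  then have "subspace y" "x \<subset> y" "y \<subset> z" by (auto simp: between_def)
  moreover from this have "dim x < dim y" "dim y < dim z"
    using assms dim_strict_mono[of x y] dim_strict_mono[of y z] by (simp_all add: diamond_def)
  ultimately show "covering x y \<and> covering y z"
    using assms by (auto simp: diamond_def covering_def)
qed (auto simp: between_def covering_def)

lemma diamondI:
  assumes "covering x y" "covering y z"
  shows "diamond x z"
  using assms by (auto simp: covering_def diamond_def)

section \<open>Red counts inside a single diamond\<close>

definition red_weight :: "('b set \<Rightarrow> 'b set \<Rightarrow> color) \<Rightarrow> 'b set \<Rightarrow> 'b set \<Rightarrow> nat" where
  "red_weight c x y = (if c x y = Red then 1 else 0)"

lemma color_not_Red: "c \<noteq> Red \<longleftrightarrow> c = Green"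
  by (cases c) auto

text \<open>The common count is 2, 1, 1, 0 in the types One, Mixed, Prime, Zero. In type Mixed the
  special middle element gives green then red, and every other one red then green.\<close>

lemma matroidal_path:
  assumes "matroidal c" "covering x y" "covering y z" "covering x y'" "covering y' z"
  shows "red_weight c x y + red_weight c y z = red_weight c x y' + red_weight c y' z"
proof -
  have d: "diamond x z" using assms diamondI by blast
  have b: "y \<in> between x z" "y' \<in> between x z" using diamond_between_iff[OF d] assms by auto
  have "type_One c x z \<or> type_Mixed c x z \<or> type_Prime c x z \<or> type_Zero c x z"
    using assms(1) d by (auto simp: matroidal_def)
  then show ?thesis
  proof (elim disjE)
    assume "type_Mixed c x z"
    then obtain m where "\<forall>y'\<in>between x z. c x y' = Green \<longleftrightarrow> y' = m"
      "\<forall>y'\<in>between x z. c y' z = Red \<longleftrightarrow> y' = m" unfolding type_Mixed_def by blast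
    then have "c x w = Red \<longleftrightarrow> w \<noteq> m" "c w z = Red \<longleftrightarrow> w = m" if "w \<in> between x z" for w
      using that color_not_Red by metis+
    then show ?thesis using b by (simp add: red_weight_def)
  qed (use b in \<open>auto simp: type_One_def type_Prime_def type_Zero_def red_weight_def\<close>)
qed

text \<open>In types Prime and Zero no upper covering is red, and in type One everything is. In type
  Mixed a red \<open>[y, z]\<close> makes \<open>y\<close> the special middle element, so the lower
  covering to any other \<open>y'\<close> is red.\<close>

lemma matroidal_local_submodular:
  assumes "matroidal c" "covering x y" "covering y z" "covering x y'" "covering y' z" "y \<noteq> y'"
  shows "red_weight c y z \<le> red_weight c x y'"
proof -
  have d: "diamond x z" using assms diamondI by blast
  have b: "y \<in> between x z" "y' \<in> between x z" using diamond_between_iff[OF d] assms by auto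
  have "type_One c x z \<or> type_Mixed c x z \<or> type_Prime c x z \<or> type_Zero c x z"
    using assms(1) d by (auto simp: matroidal_def)
  then show ?thesis
  proof (elim disjE)
    assume "type_Mixed c x z"
    then obtain m where "\<forall>y'\<in>between x z. c x y' = Green \<longleftrightarrow> y' = m"
      "\<forall>y'\<in>between x z. c y' z = Red \<longleftrightarrow> y' = m" unfolding type_Mixed_def by blast
    then have "c x w = Red \<longleftrightarrow> w \<noteq> m" "c w z = Red \<longleftrightarrow> w = m" if "w \<in> between x z" for w
      using that color_not_Red by metis+
    then show ?thesis using b assms(6) by (auto simp: red_weight_def)
  qed (use b in \<open>auto simp: type_One_def type_Prime_def type_Zero_def red_weight_def\<close>)
qed

section \<open>Red counts along paths and maximal chains\<close>

text \<open>Keeps only the top and the red count of a chain of coverings from \<open>{0}\<close>, so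
  that inductions need not handle chains as sets. It is a relation because the count may depend on
  the path until uniqueness is proved.\<close>

inductive red_path :: "('b set \<Rightarrow> 'b set \<Rightarrow> color) \<Rightarrow> 'b set \<Rightarrow> nat \<Rightarrow> bool" for c where
  zero: "red_path c {0} 0"
| step: "red_path c x n \<Longrightarrow> covering x y \<Longrightarrow> red_path c y (n + red_weight c x y)"

lemma maximal_chain_bot:
  assumes "maximal_chain {0} {0} C"
  shows "num_red c C = 0"
proof -
  have "C \<subseteq> interval {0} {0}"
    using assms by (auto simp: maximal_chain_def pred_on.maxchain_def pred_on.chain_def)
  then have "C \<subseteq> {{0}}" by (auto simp: interval_def)
  then have "{(x, y). x \<in> C \<and> y \<in> C \<and> covering x y \<and> c x y = Red} = {}"
    by (auto simp: covering_def)
  then show ?thesis by (metis (no_types, lifting) card.empty num_red_def)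
qed

text \<open>Otherwise \<open>insert y C\<close> would be a strictly larger chain.\<close>

lemma maximal_chain_insert:
  assumes "maximal_chain {0} x C" "y \<in> interval {0} x" "\<And>a. a \<in> C \<Longrightarrow> a \<subseteq> y \<or> y \<subseteq> a"
  shows "y \<in> C"
proof (rule ccontr)
  assume "y \<notin> C"
  have C: "subset.chain (interval {0} x) C"
    "\<not> (\<exists>S. subset.chain (interval {0} x) S \<and> C \<subset> S)"
    using assms(1) by (auto simp: maximal_chain_def pred_on.maxchain_def)
  have "subset.chain (interval {0} x) (insert y C)"
    using C(1) assms(2,3) unfolding subset_chain_def by blast
  then show False using C(2) \<open>y \<notin> C\<close> by blast
qed

text \<open>Turns a set-theoretic maximal chain into a last covering step and a shorter maximal
  chain. If \<open>y\<close> is the largest member below \<open>x\<close>, adjoining to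
  \<open>y\<close> a vector of \<open>x\<close> gives a subspace comparable with all of
  \<open>C\<close>; by maximality it belongs to \<open>C\<close>, hence equals
  \<open>x\<close>.\<close>

lemma maximal_chain_remove_top:
  assumes C: "maximal_chain {0} x C" and x: "subspace x" "x \<noteq> {0}"
  obtains y where "covering y x" "maximal_chain {0} y (C - {x})"
    "num_red c C = num_red c (C - {x}) + red_weight c y x"
proof -
  let ?D = "C - {x}"
  have chC: "subset.chain (interval {0} x) C"
    and mC: "\<And>S. subset.chain (interval {0} x) S \<Longrightarrow> \<not> C \<subset> S"
    using C by (auto simp: maximal_chain_def pred_on.maxchain_def)
  have sub: "subspace a \<and> 0 \<in> a \<and> a \<subseteq> x" if "a \<in> C" for a
    using chC that by (auto simp: subset_chain_def interval_def)
  have xC: "x \<in> C"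
    by (rule maximal_chain_insert[OF C]) (use x sub in \<open>auto simp: interval_def subspace_0\<close>)
  have "{0} \<in> C"
    by (rule maximal_chain_insert[OF C]) (use x sub in \<open>auto simp: interval_def subspace_0\<close>)
  then have D0: "{0} \<in> ?D" using x by auto
  \<comment> \<open>As \<open>?D\<close> is a finite nonempty chain, this union is its largest
    member.\<close>
  define y where "y = \<Union>?D"
  have chD: "subset.chain (interval {0} x) ?D"
    using chC by (auto simp: subset_chain_def)
  have fC: "finite C"
    by (rule finite_subset[of _ "Pow UNIV"]) (auto simp: finite_space simp del: Pow_UNIV)
  then have yD: "y \<in> ?D" unfolding y_def
    by (intro Union_in_chain[OF _ _ chD]) (use D0 in auto)
  have le: "a \<subseteq> y" if "a \<in> ?D" for a using that by (auto simp: y_def)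
  have y: "subspace y" "y \<subset> x" using sub[of y] yD by auto
  obtain v where v: "v \<in> x" "v \<notin> y" using y by auto
  have spy: "span y = y" using y by (simp add: span_eq_iff)
  have cov: "covering y (span (insert v y))"
    using covering_span_insert[of v y] v spy by simp
  have zx: "span (insert v y) \<subseteq> x" using x v y by (intro span_minimal) auto
  have "span (insert v y) \<in> C"
  proof (rule maximal_chain_insert[OF C])
    show "span (insert v y) \<in> interval {0} x" using zx by (auto simp: interval_def span_zero)
    fix a assume "a \<in> C"
    then show "a \<subseteq> span (insert v y) \<or> span (insert v y) \<subseteq> a"
      using zx le[of a] covering_subset[OF cov] by auto
  qed
  moreover have "\<not> span (insert v y) \<subseteq> y" using v span_base[of v "insert v y"] by auto
  ultimately have "span (insert v y) = x" using le by blast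
  with cov have covyx: "covering y x" by simp
  moreover have "maximal_chain {0} y ?D"
    unfolding maximal_chain_def pred_on.maxchain_def
  proof (intro conjI notI)
    show "subset.chain (interval {0} y) ?D"
      using chD le unfolding subset_chain_def interval_def by blast
    \<comment> \<open>A larger chain below \<open>y\<close>, with \<open>x\<close> put back on top,
      would properly extend \<open>C\<close>.\<close>
    assume "\<exists>S. subset.chain (interval {0} y) S \<and> ?D \<subset> S"
    then obtain S where S: "subset.chain (interval {0} y) S" "?D \<subset> S" by blast
    have "a \<subset> x" if "a \<in> S" for a
      using S(1) that y by (auto simp: subset_chain_def interval_def)
    then have "subset.chain (interval {0} x) (insert x S)" "x \<notin> S"
      using S(1) x(1) y(2) by (auto simp: subset_chain_def interval_def subspace_0 subset_eq)
    moreover have "C \<subset> insert x S" using S(2) \<open>x \<notin> S\<close> by blast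
    ultimately show False using mC by blast
  qed
  moreover have "num_red c C = num_red c ?D + red_weight c y x"
  proof -
    let ?P = "\<lambda>E. {(a, b). a \<in> E \<and> b \<in> E \<and> covering a b \<and> c a b = Red}"
    \<comment> \<open>The only covering in \<open>C\<close> that involves \<open>x\<close> is
      \<open>[y, x]\<close>, so removing \<open>x\<close> loses at most this one red pair.\<close>
    have top: "a = y" if "a \<in> C" "covering a x" for a
    proof -
      have "a \<subseteq> y" using that le by (auto simp: covering_def)
      moreover have "dim a = dim y" using that covyx by (auto simp: covering_def)
      ultimately show ?thesis
        using subspace_dim_equal[of a y] y sub[OF that(1)] by auto
    qed
    have bot: "\<not> covering x b" if "b \<in> C" for b
      using sub[OF that] by (auto simp: covering_def)
    have "y \<in> C" using yD by blast
    have "(a, b) \<in> ?P C \<longleftrightarrow> (a, b) \<in> ?P ?D \<or> c y x = Red \<and> a = y \<and> b = x" for a b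
      using top[of a] bot[of b] covyx xC \<open>y \<in> C\<close>
      by (cases "a = x"; cases "b = x") blast+
    then have "?P C = ?P ?D \<union> (if c y x = Red then {(y, x)} else {})"
      by (intro set_eqI) (simp only: split_paired_all, simp)
    moreover have "finite (?P ?D)"
      by (rule finite_subset[of _ "C \<times> C"]) (use fC in auto)
    moreover have "(y, x) \<notin> ?P ?D" by auto
    ultimately show ?thesis unfolding num_red_def red_weight_def by auto
  qed
  ultimately show thesis using that by blast
qed

lemma maximal_chain_red_path:
  assumes "subspace x" "maximal_chain {0} x C"
  shows "red_path c x (num_red c C)"
  using assms
proof (induction "dim x" arbitrary: x C rule: less_induct)
  case less
  show ?case
  proof (cases "x = {0}")
    case True
    then show ?thesis using less maximal_chain_bot zero by metis
  next
    case False
    then obtain y where y: "covering y x" "maximal_chain {0} y (C - {x})"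
      "num_red c C = num_red c (C - {x}) + red_weight c y x"
      using maximal_chain_remove_top less.prems by metis
    then show ?thesis
      using step less.hyps[of y "C - {x}"] by (simp add: covering_def)
  qed
qed

lemma red_path_exists: "subspace x \<Longrightarrow> \<exists>n. red_path c x n"
  using maximal_chain_exists maximal_chain_red_path by blast

section \<open>Jordan-Hoelder: independence of the path\<close>

text \<open>The sum of \<open>x\<close> and \<open>y\<close> strictly contains \<open>x\<close> and
  lies in \<open>z\<close>, so its dimension is \<open>dim x + 1\<close>; the dimension formula then
  gives that of \<open>x \<inter> y\<close>.\<close>

lemma covering_Int:
  assumes "covering x z" "covering y z" "x \<noteq> y"
  shows "covering (x \<inter> y) x" "covering (x \<inter> y) y"
proof -
  have s: "subspace x" "subspace y" "subspace z" "dim y = dim x" "dim z = dim x + 1"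
      "x \<subset> z" "y \<subset> z"
    using assms by (auto simp: covering_def)
  have nsub: "\<not> x \<subseteq> y" "\<not> y \<subseteq> x"
    using subspace_dim_equal[of x y] subspace_dim_equal[of y x] s assms(3) by auto
  let ?s = "{a + b |a b. a \<in> x \<and> b \<in> y}"
  have ss: "subspace ?s" using subspace_sums s by auto
  have "?s \<subseteq> z" using s by (auto intro: subspace_add)
  then have up: "dim ?s \<le> dim z" by (rule dim_subset)
  have "x \<subseteq> ?s" "y \<subseteq> ?s"
    using subspace_0[OF s(1)] subspace_0[OF s(2)] by (force, force)
  then have "x \<subset> ?s" using nsub by blast
  then have "dim x < dim ?s" by (rule dim_strict_mono[OF s(1) ss])
  with up have "dim ?s = dim x + 1" using s by linarith
  then have "dim x = dim (x \<inter> y) + 1" "dim y = dim (x \<inter> y) + 1"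
    using dim_sums_Int[of x y] s by linarith+
  moreover have "x \<inter> y \<subset> x" "x \<inter> y \<subset> y" using nsub by blast+
  ultimately show "covering (x \<inter> y) x" "covering (x \<inter> y) y"
    unfolding covering_def using s(1,2) subspace_inter[OF s(1,2)] by blast+
qed

text \<open>If the two paths enter \<open>x\<close> from distinct \<open>y\<close> and
  \<open>z\<close>, both are compared with a path through \<open>y \<inter> z\<close>: the induction
  hypothesis applies at \<open>y\<close> and at \<open>z\<close>, and \<open>matroidal_path\<close>
  in the diamond from \<open>y \<inter> z\<close> to \<open>x\<close> equates the totals.\<close>

lemma red_path_unique:
  assumes "matroidal c" "red_path c x m" "red_path c x n"
  shows "m = n"
  using assms(2,3)
proof (induction "dim x" arbitrary: x m n rule: less_induct)
  case less
  show ?case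
  proof (cases "x = {0}")
    case True
    then have nc: "\<not> covering y x" for y by (auto simp: covering_def)
    have "k = 0" if "red_path c x k" for k
      using that nc by cases auto
    from this[OF less.prems(1)] this[OF less.prems(2)] show ?thesis by simp
  next
    case False
    obtain y m' where y: "red_path c y m'" "covering y x" "m = m' + red_weight c y x"
      using less.prems(1) False by cases auto
    obtain z n' where z: "red_path c z n'" "covering z x" "n = n' + red_weight c z x"
      using less.prems(2) False by cases auto
    have dims: "dim y < dim x" "dim z < dim x" using y z by (auto simp: covering_def)
    show ?thesis
    proof (cases "y = z")
      case True
      then show ?thesis using less.hyps[OF dims(1) y(1), of n'] y z by simp
    next
      case False
      note w = covering_Int[OF y(2) z(2) False]
      have "subspace (y \<inter> z)" using w by (simp add: covering_def)
      then obtain k where k: "red_path c (y \<inter> z) k" using red_path_exists by blast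
      have "m' = k + red_weight c (y \<inter> z) y"
        using less.hyps[OF dims(1) y(1)] step[OF k w(1)] by blast
      moreover have "n' = k + red_weight c (y \<inter> z) z"
        using less.hyps[OF dims(2) z(1)] step[OF k w(2)] by blast
      ultimately show ?thesis
        using matroidal_path[OF assms(1) w(1) y(2) w(2) z(2)] y(3) z(3) by simp
    qed
  qed
qed

section \<open>The rank function of a coloring: bounds and monotonicity\<close>

lemma rank_of_coloring_red_path:
  assumes "subspace x"
  obtains n where "red_path c x n" "rank_of_coloring c x = int n"
  using maximal_chain_red_path[OF assms someI_ex[OF maximal_chain_exists]]
  unfolding rank_of_coloring_def by blast

lemma rank_of_coloring_eqI:
  assumes "matroidal c" "subspace x" "red_path c x n"
  shows "rank_of_coloring c x = int n"
  using red_path_unique[OF assms(1,3)] rank_of_coloring_red_path[OF assms(2)] by metis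

lemma num_red_eq_rank_of_coloring:
  assumes "matroidal c" "subspace x" "maximal_chain {0} x C"
  shows "int (num_red c C) = rank_of_coloring c x"
  using rank_of_coloring_eqI[OF assms(1,2) maximal_chain_red_path[OF assms(2,3)]] by simp

text \<open>A path to \<open>x\<close> prolonged by \<open>[x, y]\<close> is a path to
  \<open>y\<close>, and any path computes the rank. Monotonicity, submodularity and the recovery of
  the coloring rest on this increment.\<close>

lemma rank_of_coloring_covering:
  assumes "matroidal c" "covering x y"
  shows "rank_of_coloring c y = rank_of_coloring c x + int (red_weight c x y)"
proof -
  have s: "subspace x" "subspace y" using assms(2) by (auto simp: covering_def)
  obtain n where "red_path c x n" using red_path_exists[OF s(1)] by blast
  then show ?thesis
    using rank_of_coloring_eqI[OF assms(1) s(1)] rank_of_coloring_eqI[OF assms(1) s(2)]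
      step[OF _ assms(2)] by fastforce
qed

lemma red_path_le_dim: "red_path c x n \<Longrightarrow> n \<le> dim x"
  by (induction rule: red_path.induct) (auto simp: covering_def red_weight_def)

lemma rank_of_coloring_bounds:
  assumes "subspace x"
  shows "0 \<le> rank_of_coloring c x" "rank_of_coloring c x \<le> int (dim x)"
  using rank_of_coloring_red_path[OF assms, of c "0 \<le> rank_of_coloring c x"]
    rank_of_coloring_red_path[OF assms, of c "rank_of_coloring c x \<le> int (dim x)"]
    red_path_le_dim by simp_all

lemma rank_of_coloring_insert_mono:
  assumes "matroidal c"
  shows "rank_of_coloring c (span S) \<le> rank_of_coloring c (span (insert v S))"
proof (cases "v \<in> span S")
  case True
  then show ?thesis by (simp add: span_redundant)
next
  case False
  then show ?thesis
    using rank_of_coloring_covering[OF assms covering_span_insert] by simp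
qed

lemma rank_of_coloring_mono:
  assumes "matroidal c" "subspace x" "subspace y" "x \<subseteq> y"
  shows "rank_of_coloring c x \<le> rank_of_coloring c y"
proof -
  \<comment> \<open>Stated for an arbitrary set \<open>T\<close> to allow induction;
    \<open>T = y\<close> gives the claim.\<close>
  have "rank_of_coloring c (span x) \<le> rank_of_coloring c (span (T \<union> x))" for T
    using finite_space[of T]
  proof (induction T)
    case (insert v T)
    then show ?case using rank_of_coloring_insert_mono[OF assms(1), of "T \<union> x" v] by simp
  qed simp
  from this[of y] show ?thesis
    using assms by (simp add: span_eq_iff[THEN iffD2] Un_absorb2)
qed

section \<open>Submodularity, from single vectors to subspaces\<close>

text \<open>If one vector is redundant over the other, the top span equals one of the middle spans
  and monotonicity suffices. Otherwise the four spans form part of a diamond with two distinct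
  middle elements, where the local inequality applies.\<close>

lemma rank_of_coloring_submodular_insert:
  assumes "matroidal c"
  shows "rank_of_coloring c (span (insert u (insert v S))) + rank_of_coloring c (span S)
    \<le> rank_of_coloring c (span (insert u S)) + rank_of_coloring c (span (insert v S))"
proof (cases "u \<in> span (insert v S) \<or> v \<in> span (insert u S)")
  case True
  then have "span (insert u (insert v S)) = span (insert v S)
      \<or> span (insert u (insert v S)) = span (insert u S)"
    using span_redundant[of u "insert v S"] span_redundant[of v "insert u S"]
    by (auto simp only: insert_commute[of u v S])
  then show ?thesis
    using rank_of_coloring_insert_mono[OF assms, of S u]
      rank_of_coloring_insert_mono[OF assms, of S v] by (elim disjE) simp_all
next
  case False
  then have *: "u \<notin> span S" "v \<notin> span S"
    using span_mono[of S "insert v S"] span_mono[of S "insert u S"] by auto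
  have cov: "covering (span S) (span (insert v S))"
      "covering (span S) (span (insert u S))"
      "covering (span (insert v S)) (span (insert u (insert v S)))"
    using * False by (simp_all add: covering_span_insert)
  have cov': "covering (span (insert u S)) (span (insert u (insert v S)))"
    using False covering_span_insert[of v "insert u S"] by (simp add: insert_commute)
  have "span (insert v S) \<noteq> span (insert u S)"
    using False span_base[of u "insert u S"] by auto
  then show ?thesis
    using matroidal_local_submodular[OF assms cov(1,3,2) cov']
      cov[THEN rank_of_coloring_covering[OF assms]] by simp
qed

text \<open>Two successive inductions adjoin the vectors of \<open>U\<close> and then those of
  \<open>T\<close>; adding the inequality for each new vector telescopes.\<close>

lemma rank_of_coloring_submodular_span:
  assumes "matroidal c"
  shows "rank_of_coloring c (span (T \<union> (U \<union> S))) + rank_of_coloring c (span S)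
    \<le> rank_of_coloring c (span (T \<union> S)) + rank_of_coloring c (span (U \<union> S))"
proof -
  \<comment> \<open>\<open>S\<close> is generalized because the induction over \<open>T\<close> uses
    this with \<open>T \<union> S\<close> in its place.\<close>
  have one: "rank_of_coloring c (span (insert u (U \<union> S))) + rank_of_coloring c (span S)
    \<le> rank_of_coloring c (span (insert u S)) + rank_of_coloring c (span (U \<union> S))" for u U S
    using finite_space[of U]
  proof (induction U)
    case (insert v U)
    then show ?case
      using rank_of_coloring_submodular_insert[OF assms, of u v "U \<union> S"] by simp
  qed simp
  show ?thesis
    using finite_space[of T]
  proof (induction T)
    case (insert u T)
    then show ?case
      using one[of u U "T \<union> S"] by (simp add: Un_left_commute)
  qed simp
qed

lemma span_Un_sums:
  assumes "subspace A" "subspace B"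
  shows "span (A \<union> B) = {a + b |a b. a \<in> A \<and> b \<in> B}"
  using assms by (simp add: span_Un span_eq_iff[THEN iffD2])

lemma q_matroid_rank_of_coloring:
  assumes "matroidal c"
  shows "q_matroid (rank_of_coloring c)"
  unfolding q_matroid_def
proof (intro conjI allI impI)
  fix A B assume s: "subspace A" "subspace B"
  \<comment> \<open>With \<open>A \<inter> B\<close> as the common base set, the inequality for
    spans becomes (R3).\<close>
  have "A \<union> (B \<union> (A \<inter> B)) = A \<union> B" "A \<union> (A \<inter> B) = A" "B \<union> (A \<inter> B) = B" by auto
  then have "rank_of_coloring c (span (A \<union> B)) + rank_of_coloring c (span (A \<inter> B))
      \<le> rank_of_coloring c (span A) + rank_of_coloring c (span B)"
    using rank_of_coloring_submodular_span[OF assms, of A B "A \<inter> B"] by simp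
  then show "rank_of_coloring c {a + b |a b. a \<in> A \<and> b \<in> B} + rank_of_coloring c (A \<inter> B)
      \<le> rank_of_coloring c A + rank_of_coloring c B"
    using s subspace_inter[OF s] by (simp add: span_Un_sums span_eq_iff[THEN iffD2])
qed (use rank_of_coloring_bounds rank_of_coloring_mono[OF assms] in auto)

section \<open>The coloring of a rank function and the correspondence\<close>

lemma coloring_of_rank_of_coloring:
  assumes "matroidal c" "covering x y"
  shows "coloring_of_rank (rank_of_coloring c) x y = c x y"
  using rank_of_coloring_covering[OF assms]
  by (auto simp: coloring_of_rank_def red_weight_def color_not_Red split: if_splits)

text \<open>Here \<open>y\<close> is the sum of \<open>x\<close> and the line through some
  \<open>v\<close>, so (R3) and (R1) bound the increment by the rank of that line, at most 1; (R2)
  makes it nonnegative.\<close>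

lemma q_matroid_covering:
  assumes "q_matroid \<rho>" "covering x y"
  shows "\<rho> y = \<rho> x + int (red_weight (coloring_of_rank \<rho>) x y)"
proof -
  have xy: "subspace x" "subspace y" "x \<subset> y" using assms(2) by (auto simp: covering_def)
  then obtain v where v: "v \<in> y" "v \<notin> x" by auto
  have "y = span (x \<union> {v})"
    using covering_eq_span_insert[OF assms(2) v] by simp
  then have y: "y = {a + b |a b. a \<in> x \<and> b \<in> span {v}}"
    using xy by (simp only: span_Un span_eq_iff[THEN iffD2])
  have "\<rho> y + \<rho> (x \<inter> span {v}) \<le> \<rho> x + \<rho> (span {v})"
    using assms(1) xy unfolding q_matroid_def y by blast
  moreover have "0 \<le> \<rho> (x \<inter> span {v})"
    using assms(1) xy subspace_inter unfolding q_matroid_def by auto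
  moreover have "\<rho> (span {v}) \<le> int (dim (span {v}))"
    using assms(1) subspace_span unfolding q_matroid_def by blast
  moreover have "dim (span {v}) \<le> 1" by simp
  moreover have "\<rho> x \<le> \<rho> y"
    using assms(1) xy unfolding q_matroid_def by auto
  ultimately show ?thesis
    by (auto simp: red_weight_def coloring_of_rank_def)
qed

lemma q_matroid_red_path:
  assumes "q_matroid \<rho>" "red_path (coloring_of_rank \<rho>) x n"
  shows "\<rho> x = int n"
  using assms(2)
proof induction
  case zero
  \<comment> \<open>(R1) in dimension 0 fixes the starting value of the count.\<close>
  have "0 \<le> \<rho> {0}" "\<rho> {0} \<le> int (dim {0})"
    using assms(1) subspace_single_0 unfolding q_matroid_def by blast+
  then show ?case by simp
next
  case (step x n y)
  then show ?case using q_matroid_covering[OF assms(1)] by simp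
qed

lemma rank_of_coloring_of_rank:
  assumes "q_matroid \<rho>" "subspace x"
  shows "rank_of_coloring (coloring_of_rank \<rho>) x = \<rho> x"
  using q_matroid_red_path[OF assms(1)] rank_of_coloring_red_path[OF assms(2)] by metis

text \<open>A rank difference of 0 across the diamond forces type Zero and 2 forces type One. A
  difference of 1 gives Prime if no lower covering is green, and Mixed otherwise.\<close>

lemma q_matroid_matroidal:
  assumes q: "q_matroid \<rho>"
  shows "matroidal (coloring_of_rank \<rho>)"
  unfolding matroidal_def
proof (intro allI impI)
  fix x z assume d: "diamond x z"
  let ?c = "coloring_of_rank \<rho>"
  have step: "\<rho> x \<le> \<rho> y \<and> \<rho> y \<le> \<rho> x + 1 \<and> \<rho> y \<le> \<rho> z \<and> \<rho> z \<le> \<rho> y + 1"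
    if "y \<in> between x z" for y
    using that diamond_between_iff[OF d] q_matroid_covering[OF q, of x y]
      q_matroid_covering[OF q, of y z] by (auto simp: red_weight_def)
  \<comment> \<open>Some middle element is needed to bound \<open>\<rho> z - \<rho> x\<close> by two
    increments.\<close>
  obtain y0 where y0: "y0 \<in> between x z"
  proof -
    obtain v where v: "v \<in> z" "v \<notin> x" using d by (auto simp: diamond_def)
    have s: "span x = x" "subspace z" "x \<subseteq> z" "dim z = dim x + 2"
      using d by (auto simp: diamond_def span_eq_iff)
    have c: "covering x (span (insert v x))" using covering_span_insert[of v x] v s by simp
    have "span (insert v x) \<subseteq> z" using s v by (intro span_minimal) auto
    then have "span (insert v x) \<in> between x z"
      using c s by (auto simp: between_def covering_def)
    then show thesis by (rule that)
  qed
  show "type_One ?c x z \<or> type_Mixed ?c x z \<or> type_Prime ?c x z \<or> type_Zero ?c x z"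
  proof (cases "\<rho> z = \<rho> x + 1")
    case False
    then consider "\<rho> z = \<rho> x" | "\<rho> z = \<rho> x + 2" using step[OF y0] by linarith
    then show ?thesis
    proof cases
      case 1
      then have "type_Zero ?c x z"
        using step by (fastforce simp: type_Zero_def coloring_of_rank_def)
      then show ?thesis by simp
    next
      case 2
      then have "type_One ?c x z"
        using step by (fastforce simp: type_One_def coloring_of_rank_def)
      then show ?thesis by simp
    qed
  next
    case z: True
    show ?thesis
    proof (cases "\<exists>y\<in>between x z. \<rho> y = \<rho> x")
      case False
      then have "\<rho> y = \<rho> x + 1" if "y \<in> between x z" for y using step[OF that] that by force
      then have "type_Prime ?c x z" using z by (simp add: type_Prime_def coloring_of_rank_def)
      then show ?thesis by simp
    next
      case True
      then obtain y where y: "y \<in> between x z" "\<rho> y = \<rho> x" by blast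
      \<comment> \<open>Two distinct middle elements meet in \<open>x\<close> and sum to
        \<open>z\<close>, so (R3) with \<open>\<rho> y = \<rho> x\<close> yields
        \<open>\<rho> z \<le> \<rho> y'\<close>: no second lower covering is green.\<close>
      have other: "\<rho> y' = \<rho> x + 1" if y': "y' \<in> between x z" "y' \<noteq> y" for y'
      proof -
        have cov: "covering x y" "covering y z" "covering x y'" "covering y' z"
          using diamond_between_iff[OF d] y y' by auto
        then have s: "subspace x" "subspace y" "subspace y'" "subspace z" "x \<subseteq> y" "x \<subseteq> y'"
          "dim y = dim x + 1" "dim y' = dim x + 1" "y \<subseteq> z" "y' \<subseteq> z"
          by (auto simp: covering_def)
        have "covering (y \<inter> y') y" using covering_Int cov y'(2) by metis
        then have I: "y \<inter> y' = x"
          using subspace_dim_equal[of x "y \<inter> y'"] s by (auto simp: covering_def)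
        let ?s = "{a + b |a b. a \<in> y \<and> b \<in> y'}"
        have "?s \<subseteq> z" using s by (auto intro: subspace_add)
        moreover have "dim ?s = dim z"
          using dim_sums_Int[of y y'] s I d by (simp add: diamond_def)
        ultimately have "?s = z"
          using subspace_dim_equal[of ?s z] subspace_sums[of y y'] s by simp
        moreover have "\<rho> ?s + \<rho> (y \<inter> y') \<le> \<rho> y + \<rho> y'"
          using q s unfolding q_matroid_def by blast
        ultimately have "\<rho> z \<le> \<rho> y'" using I y by simp
        then show ?thesis using z step[OF y'(1)] by linarith
      qed
      have "type_Mixed ?c x z"
        unfolding type_Mixed_def
        by (rule bexI[OF _ y(1)]) (use y z other in \<open>force simp: coloring_of_rank_def\<close>)
      then show ?thesis by simp
    qed
  qed
qed

end

text \<open>The last conjunct of each half says that the two constructions undo each other; colors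
  are compared on coverings only, since other values carry no meaning.\<close>

theorem theorem2:
  fixes scale :: "'f::{field,finite} \<Rightarrow> 'v::ab_group_add \<Rightarrow> 'v"
    and Basis :: "'v set" and q k :: nat
  assumes "primepow q" and "card (UNIV :: 'f set) = q"
    and "finite_dimensional_vector_space scale Basis"
    and "vector_space.dim scale (UNIV :: 'v set) = k"
  shows
    "(\<forall>c. subspace_lattice.matroidal scale c \<longrightarrow>
        (\<forall>x C. module.subspace scale x \<longrightarrow> subspace_lattice.maximal_chain scale {0} x C \<longrightarrow>
           int (subspace_lattice.num_red scale c C) = subspace_lattice.rank_of_coloring scale c x) \<and>
        subspace_lattice.q_matroid scale (subspace_lattice.rank_of_coloring scale c) \<and>
        (\<forall>x y. subspace_lattice.covering scale x y \<longrightarrow>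
           coloring_of_rank (subspace_lattice.rank_of_coloring scale c) x y = c x y)) \<and>
     (\<forall>\<rho>. subspace_lattice.q_matroid scale \<rho> \<longrightarrow>
        subspace_lattice.matroidal scale (coloring_of_rank \<rho>) \<and>
        (\<forall>x. module.subspace scale x \<longrightarrow>
           subspace_lattice.rank_of_coloring scale (coloring_of_rank \<rho>) x = \<rho> x))"
proof -
  interpret finite_dimensional_vector_space scale Basis by fact
  interpret finite_subspace_lattice scale Basis by unfold_locales
  show ?thesis
    by (intro conjI allI impI)
      (simp_all add: num_red_eq_rank_of_coloring q_matroid_rank_of_coloring
        coloring_of_rank_of_coloring q_matroid_matroidal rank_of_coloring_of_rank)
qed

end
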